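(* Let $(X,f_{1,\infty})$ and $(Y,g_{1,\infty})$ be non-autonomous discrete systems with $f_{1,\infty}$ and $g_{1,\infty}$ feeble open and surjective, $f_{1,\infty}$ converging uniformly to a map $f$ and $g_{1,\infty}$ converging uniformly to a map $g$. Suppose that $\{f_n^{n+k}\}_{k\in\mathbb{N}}$ converges collectively to $\{f^k\}_{k\in\mathbb{N}}$ and that $\{g_n^{n+k}\}_{k\in\mathbb{N}}$ converges collectively to $\{g^k\}_{k\in\mathbb{N}}$. If $f_{1,\infty}$ and $g_{1,\infty}$ are both syndetically transitive and weakly mixing, then $f_{1,\infty}\times g_{1,\infty}$ is syndetically transitive and weakly mixing.
   Context: $\mathbb{N}=\{1,2,3,\dots\}$. A non-autonomous discrete system $(X,f_{1,\infty})$ consists of a compact metric space $(X,d)$ and a sequence $f_{1,\infty}=\{f_n\}_{n=1}^\infty$ of continuous maps $f_n:X\to X$. For $i,n\in\mathbb{N}$, $f_i^n:=f_{i+(n-1)}\circ\cdots\circ f_i$ (a composition of $n$ maps), and $f_i^0=id_X$. The product system $f_{1,\infty}\times g_{1,\infty}$ on $X\times Y$ is the sequence $\{f_n\times g_n\}_{n=1}^\infty$. Uniform convergence of $f_{1,\infty}$ to $f:X\to X$ means $D(f_n,f)\to 0$, where $D(h_1,h_2)=\sup_{x\in X}d(h_1(x),h_2(x))$. "$\{f_n^{n+k}\}_{k\in\mathbb{N}}$ converges collectively to $\{f^k\}_{k\in\mathbb{N}}$" means: for every $\varepsilon>0$ there exists $r_0\in\mathbb{N}$ such that $D(f_r^k,f^k)<\varepsilon$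 for all $r\ge r_0$ and all $k\in\mathbb{N}$, where $f_r^k=f_{r+k-1}\circ\cdots\circ f_r$ and $f^k$ is the $k$-fold composition of $f$. (Likewise for $g_{1,\infty}$ on $Y$.) $f_{1,\infty}$ is surjective if every $f_i$ is surjective. It is feeble open if $\mathrm{int}(f_i(U))\neq\emptyset$ for every nonempty open $U\subseteq X$ and every $i\in\mathbb{N}$. A set $A\subseteq\mathbb{N}$ is syndetic if there is a positive integer $M$ with $\{i,i+1,\dots,i+M\}\cap A\neq\emptyset$ for every $i\in\mathbb{N}$. The system is syndetically transitive if for any two nonempty open subsets $U,V\subseteq X$ the set $\{n\in\mathbb{N}: f_1^n(U)\cap V\neq\emptyset\}$ is syndetic. It is weakly mixing if for any four nonempty open subsets $U_1,U_2,V_1,V_2\subseteq X$ there exists $n\in\mathbb{N}$ such that $f_1^n(U_1)\cap V_1\neq\emptyset$ and $f_1^n(U_2)\cap V_2\neq\emptyset$. *)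

theory Defs
  imports "HOL-Analysis.Analysis"
begin

(* Conventions: the space X is the whole type 'a. A sequence of maps f_1, f_2, ... is a
   function on nat of which only the values at indices >= 1 are ever used; f 0 is
   irrelevant everywhere. *)

definition nonautonomous_system :: "(nat \<Rightarrow> 'a::metric_space \<Rightarrow> 'a) \<Rightarrow> bool" where
  "nonautonomous_system f \<longleftrightarrow>
     compact (UNIV :: 'a set) \<and> (\<forall>n\<ge>1. continuous_on UNIV (f n))"

(* compose_from f i n is f_(i+n-1) o ... o f_(i+1) o f_i, a composition of n maps. *)
primrec compose_from :: "(nat \<Rightarrow> 'a \<Rightarrow> 'a) \<Rightarrow> nat \<Rightarrow> nat \<Rightarrow> 'a \<Rightarrow> 'a" where
  "compose_from f i 0 = id"
| "compose_from f i (Suc n) = f (i + n) \<circ> compose_from f i n"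

definition product_system ::
  "(nat \<Rightarrow> 'a \<Rightarrow> 'a) \<Rightarrow> (nat \<Rightarrow> 'b \<Rightarrow> 'b) \<Rightarrow> nat \<Rightarrow> 'a \<times> 'b \<Rightarrow> 'a \<times> 'b" where
  "product_system f g n = map_prod (f n) (g n)"

(* The supremum is taken in the reals; it is a genuine supremum whenever the space is
   bounded, in particular on a compact space. *)
definition sup_dist :: "('a \<Rightarrow> 'a::metric_space) \<Rightarrow> ('a \<Rightarrow> 'a) \<Rightarrow> real" where
  "sup_dist h1 h2 = (SUP x. dist (h1 x) (h2 x))"

definition converges_uniformly ::
  "(nat \<Rightarrow> 'a::metric_space \<Rightarrow> 'a) \<Rightarrow> ('a \<Rightarrow> 'a) \<Rightarrow> bool" where
  "converges_uniformly f F \<longleftrightarrow> (\<lambda>n. sup_dist (f n) F) \<longlonglongrightarrow> 0"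

definition converges_collectively ::
  "(nat \<Rightarrow> 'a::metric_space \<Rightarrow> 'a) \<Rightarrow> ('a \<Rightarrow> 'a) \<Rightarrow> bool" where
  "converges_collectively f F \<longleftrightarrow>
     (\<forall>\<epsilon>>0. \<exists>r0\<ge>1. \<forall>r\<ge>r0. \<forall>k\<ge>1. sup_dist (compose_from f r k) (F ^^ k) < \<epsilon>)"

definition surjective_system :: "(nat \<Rightarrow> 'a \<Rightarrow> 'a) \<Rightarrow> bool" where
  "surjective_system f \<longleftrightarrow> (\<forall>i\<ge>1. surj (f i))"

definition feeble_open :: "(nat \<Rightarrow> 'a::topological_space \<Rightarrow> 'a) \<Rightarrow> bool" where
  "feeble_open f \<longleftrightarrow>
     (\<forall>U. open U \<and> U \<noteq> {} \<longrightarrow> (\<forall>i\<ge>1. interior (f i ` U) \<noteq> {}))"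

definition syndetic :: "nat set \<Rightarrow> bool" where
  "syndetic A \<longleftrightarrow> (\<exists>M>0. \<forall>i\<ge>1. {i..i + M} \<inter> A \<noteq> {})"

definition syndetically_transitive :: "(nat \<Rightarrow> 'a::topological_space \<Rightarrow> 'a) \<Rightarrow> bool" where
  "syndetically_transitive f \<longleftrightarrow>
     (\<forall>U V. open U \<and> U \<noteq> {} \<and> open V \<and> V \<noteq> {} \<longrightarrow>
        syndetic {n. n \<ge> 1 \<and> compose_from f 1 n ` U \<inter> V \<noteq> {}})"

definition weakly_mixing :: "(nat \<Rightarrow> 'a::topological_space \<Rightarrow> 'a) \<Rightarrow> bool" where
  "weakly_mixing f \<longleftrightarrow>
     (\<forall>U1 U2 V1 V2. open U1 \<and> U1 \<noteq> {} \<and> open U2 \<and> U2 \<noteq> {} \<and>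
        open V1 \<and> V1 \<noteq> {} \<and> open V2 \<and> V2 \<noteq> {} \<longrightarrow>
        (\<exists>n\<ge>1. compose_from f 1 n ` U1 \<inter> V1 \<noteq> {} \<and> compose_from f 1 n ` U2 \<inter> V2 \<noteq> {}))"

end

theory Submission
  imports Defs
begin

text \<open>
  Call a set of times thickly syndetic if, for every \<open>k\<close>, the starting points of its runs of length
  \<open>k\<close> form a syndetic set. Such sets are closed under finite intersections and translations, so it
  suffices to show that in each factor all sets of hitting times are thickly syndetic.

  Collective convergence transfers hitting times between the sequence and its limit map, up to a
  shift by some \<open>r\<close>: surjectivity pulls open sets back along \<open>f\<^sub>1\<^sup>r\<close>, feeble openness pushes
  them forward. So the limit \<open>F\<close> is syndetically transitive and weakly mixing. Since
  \<open>F\<close> commutes with its powers, Furstenberg's trick puts a hitting set \<open>N(W, Z)\<close>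
  inside \<open>N(U, V) \<inter> N(U, F\<^sup>-\<^sup>1 V) \<inter> \<dots> \<inter> N(U, F\<^sup>-\<^sup>k V)\<close>, which makes \<open>N(U, V)\<close> thickly syndetic.
\<close>

section \<open>Thickly syndetic sets\<close>

definition thickly_syndetic :: "nat set \<Rightarrow> bool" where
  "thickly_syndetic A \<longleftrightarrow> (\<forall>k. syndetic {n. {n..n + k} \<subseteq> A})"

lemma syndeticI:
  assumes "\<And>i. i \<ge> 1 \<Longrightarrow> \<exists>n\<in>A. i \<le> n \<and> n \<le> i + M"
  shows "syndetic A"
  unfolding syndetic_def
\<comment> \<open>\<open>M\<close> may be 0, while \<open>syndetic\<close> asks for a positive
  bound; hence \<open>Suc M\<close>.\<close>
proof (intro exI[of _ "Suc M"] conjI allI impI)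
  fix i :: nat assume "i \<ge> 1"
  from assms[OF this] obtain n where "n \<in> A" "i \<le> n" "n \<le> i + M" by blast
  then have "n \<in> {i..i + Suc M} \<inter> A" by simp
  then show "{i..i + Suc M} \<inter> A \<noteq> {}" by blast
qed simp

lemma syndeticE:
  assumes "syndetic A"
  obtains M where "\<And>i. i \<ge> 1 \<Longrightarrow> \<exists>n\<in>A. i \<le> n \<and> n \<le> i + M"
proof -
  from assms obtain M where "\<forall>i\<ge>1. {i..i + M} \<inter> A \<noteq> {}"
    unfolding syndetic_def by blast
  then have "\<exists>n\<in>A. i \<le> n \<and> n \<le> i + M" if "i \<ge> 1" for i
  proof -
    from \<open>\<forall>i\<ge>1. {i..i + M} \<inter> A \<noteq> {}\<close> that obtain n where "n \<in> {i..i + M} \<inter> A" by blast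
    then show ?thesis by auto
  qed
  then show thesis by (rule that)
qed

lemma syndetic_mono:
  assumes "syndetic A" "A \<subseteq> B"
  shows "syndetic B"
  using assms(1)
proof (rule syndeticE)
  fix M assume "\<And>i. i \<ge> 1 \<Longrightarrow> \<exists>n\<in>A. i \<le> n \<and> n \<le> i + M"
  then show "syndetic B" using assms(2) by (intro syndeticI[where M = M]) blast
qed

lemma thickly_syndetic_mono:
  assumes "thickly_syndetic A" "A \<subseteq> B"
  shows "thickly_syndetic B"
  unfolding thickly_syndetic_def
proof
  fix k
  have "syndetic {n. {n..n + k} \<subseteq> A}"
    using assms(1) by (simp add: thickly_syndetic_def)
  then show "syndetic {n. {n..n + k} \<subseteq> B}"
    by (rule syndetic_mono) (use assms(2) in blast)
qed

lemma thickly_syndetic_imp_syndetic: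
  assumes "thickly_syndetic A"
  shows "syndetic A"
proof -
  have "syndetic {n. {n..n + 0} \<subseteq> A}"
    using assms unfolding thickly_syndetic_def by blast
  then show ?thesis by simp
qed

lemma thickly_syndetic_nonempty:
  assumes "thickly_syndetic A"
  shows "A \<noteq> {}"
proof -
  obtain M where "\<And>i. i \<ge> 1 \<Longrightarrow> \<exists>n\<in>A. i \<le> n \<and> n \<le> i + M"
    using thickly_syndetic_imp_syndetic[OF assms] by (rule syndeticE) blast
  from this[of 1] show ?thesis by auto
qed

text \<open>If runs of length \<open>k\<close> in \<open>B\<close> start within every gap of
  \<open>M\<close>, then any run of length \<open>M + k\<close> in \<open>A\<close> contains one of
  them completely. Syndetic sets as such lack this property, since two of them may be
  disjoint.\<close>

lemma thickly_syndetic_Int: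
  assumes "thickly_syndetic A" "thickly_syndetic B"
  shows "thickly_syndetic (A \<inter> B)"
  unfolding thickly_syndetic_def
proof
  fix k
  from assms(2) have "syndetic {n. {n..n + k} \<subseteq> B}"
    by (simp add: thickly_syndetic_def)
  then obtain M where M: "\<And>i. i \<ge> 1 \<Longrightarrow> \<exists>n\<in>{n. {n..n + k} \<subseteq> B}. i \<le> n \<and> n \<le> i + M"
    by (rule syndeticE) blast
  from assms(1) have "syndetic {n. {n..n + (M + k)} \<subseteq> A}"
    by (simp add: thickly_syndetic_def)
  then obtain L where L: "\<And>i. i \<ge> 1 \<Longrightarrow> \<exists>n\<in>{n. {n..n + (M + k)} \<subseteq> A}. i \<le> n \<and> n \<le> i + L"
    by (rule syndeticE) blast
  show "syndetic {n. {n..n + k} \<subseteq> A \<inter> B}"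
  proof (rule syndeticI[where M = "L + M"])
    fix i :: nat assume i: "i \<ge> 1"
    from L[OF i] obtain n where n: "{n..n + (M + k)} \<subseteq> A" "i \<le> n" "n \<le> i + L" by blast
    from M[of n] i n(2) obtain m where m: "{m..m + k} \<subseteq> B" "n \<le> m" "m \<le> n + M" by auto
    have "{m..m + k} \<subseteq> {n..n + (M + k)}" using m by auto
    then have "{m..m + k} \<subseteq> A \<inter> B" using n m by blast
    then show "\<exists>m\<in>{n. {n..n + k} \<subseteq> A \<inter> B}. i \<le> m \<and> m \<le> i + (L + M)"
      using n m by (intro bexI[of _ m]) auto
  qed
qed

text \<open>This absorbs the delay \<open>r\<close> that arises on passing from the limit map back
  to the sequence: runs move by \<open>r\<close>, and gaps grow by at most \<open>r\<close>.\<close>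

lemma thickly_syndetic_translate:
  assumes "thickly_syndetic A" "\<And>n. n \<in> A \<Longrightarrow> r + n \<in> B"
  shows "thickly_syndetic B"
  unfolding thickly_syndetic_def
proof
  fix k
  from assms(1) have "syndetic {n. {n..n + k} \<subseteq> A}"
    by (simp add: thickly_syndetic_def)
  then obtain M where M: "\<And>i. i \<ge> 1 \<Longrightarrow> \<exists>n\<in>{n. {n..n + k} \<subseteq> A}. i \<le> n \<and> n \<le> i + M"
    by (rule syndeticE) blast
  show "syndetic {n. {n..n + k} \<subseteq> B}"
  proof (rule syndeticI[where M = "r + M"])
    fix i :: nat assume i: "i \<ge> 1"
    from M[OF i] obtain n where n: "{n..n + k} \<subseteq> A" "i \<le> n" "n \<le> i + M" by blast
    have "{r + n..r + n + k} \<subseteq> B"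
    proof
      fix m assume m: "m \<in> {r + n..r + n + k}"
      then have "m - r \<in> {n..n + k}" by auto
      then have "m - r \<in> A" using n(1) by blast
      with assms(2)[of "m - r"] m show "m \<in> B" by simp
    qed
    then show "\<exists>m\<in>{n. {n..n + k} \<subseteq> B}. i \<le> m \<and> m \<le> i + (r + M)"
      using n by (intro bexI[of _ "r + n"]) auto
  qed
qed

section \<open>Hitting times of a single map\<close>

text \<open>The family \<open>h\<close> is arbitrary so that \<open>compose_from f 1\<close> and the
  powers of a single map are covered alike.\<close>

definition hitting_times :: "(nat \<Rightarrow> 'a \<Rightarrow> 'a) \<Rightarrow> 'a set \<Rightarrow> 'a set \<Rightarrow> nat set" where
  "hitting_times h U V = {n. n \<ge> 1 \<and> h n ` U \<inter> V \<noteq> {}}"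

lemma hitting_timesI: "n \<ge> 1 \<Longrightarrow> x \<in> U \<Longrightarrow> h n x \<in> V \<Longrightarrow> n \<in> hitting_times h U V"
  unfolding hitting_times_def by blast

lemma hitting_timesE:
  assumes "n \<in> hitting_times h U V"
  obtains x where "n \<ge> 1" "x \<in> U" "h n x \<in> V"
  using assms unfolding hitting_times_def by blast

lemma hitting_times_mono:
  "U \<subseteq> U' \<Longrightarrow> V \<subseteq> V' \<Longrightarrow> hitting_times h U V \<subseteq> hitting_times h U' V'"
  unfolding hitting_times_def by blast

lemma weakly_mixing_iff:
  "weakly_mixing f \<longleftrightarrow>
     (\<forall>U1 U2 V1 V2. open U1 \<and> U1 \<noteq> {} \<and> open U2 \<and> U2 \<noteq> {} \<and>
        open V1 \<and> V1 \<noteq> {} \<and> open V2 \<and> V2 \<noteq> {} \<longrightarrow>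
        hitting_times (compose_from f 1) U1 V1 \<inter> hitting_times (compose_from f 1) U2 V2 \<noteq> {})"
proof -
  have "(\<exists>n\<ge>1. compose_from f 1 n ` U1 \<inter> V1 \<noteq> {} \<and> compose_from f 1 n ` U2 \<inter> V2 \<noteq> {}) \<longleftrightarrow>
      hitting_times (compose_from f 1) U1 V1 \<inter> hitting_times (compose_from f 1) U2 V2 \<noteq> {}"
    for U1 U2 V1 V2
    unfolding hitting_times_def by blast
  then show ?thesis unfolding weakly_mixing_def by simp
qed

lemma syndetically_transitive_iff:
  "syndetically_transitive f \<longleftrightarrow>
     (\<forall>U V. open U \<and> U \<noteq> {} \<and> open V \<and> V \<noteq> {} \<longrightarrow>
        syndetic (hitting_times (compose_from f 1) U V))"
  unfolding syndetically_transitive_def hitting_times_def ..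

lemma open_vimage_funpow:
  fixes F :: "'a::topological_space \<Rightarrow> 'a"
  assumes "continuous_on UNIV F" "open V"
  shows "open ((F ^^ n) -` V)"
proof (induction n)
  case (Suc n)
  have "(F ^^ Suc n) -` V = F -` ((F ^^ n) -` V)"
    by (simp only: funpow_Suc_right vimage_comp)
  then show ?case using open_vimage[OF Suc assms(1)] by (simp only:)
qed (use assms in simp)

lemma thickly_syndetic_hitting_times_funpow:
  fixes F :: "'a::topological_space \<Rightarrow> 'a"
  assumes cont: "continuous_on UNIV F"
    and trans: "\<And>U V. open U \<Longrightarrow> U \<noteq> {} \<Longrightarrow> open V \<Longrightarrow> V \<noteq> {} \<Longrightarrow>
      syndetic (hitting_times (\<lambda>n. F ^^ n) U V)"
    and mix: "\<And>U1 U2 V1 V2. open U1 \<Longrightarrow> U1 \<noteq> {} \<Longrightarrow> open U2 \<Longrightarrow> U2 \<noteq> {} \<Longrightarrow>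
      open V1 \<Longrightarrow> V1 \<noteq> {} \<Longrightarrow> open V2 \<Longrightarrow> V2 \<noteq> {} \<Longrightarrow>
      hitting_times (\<lambda>n. F ^^ n) U1 V1 \<inter> hitting_times (\<lambda>n. F ^^ n) U2 V2 \<noteq> {}"
    and U: "open U" "U \<noteq> {}" and V: "open V" "V \<noteq> {}"
  shows "thickly_syndetic (hitting_times (\<lambda>n. F ^^ n) U V)"
proof -
  let ?N = "hitting_times (\<lambda>n. F ^^ n)"
  \<comment> \<open>Weak mixing stands in for surjectivity of \<open>F\<close>: if \<open>B\<close>
    is hit at a time \<open>n\<close> of at least 1, the point reached at time \<open>n - 1\<close>
    is a preimage.\<close>
  have vne: "F -` B \<noteq> {}" if "open B" "B \<noteq> {}" for B
  proof -
    from mix[of UNIV UNIV B B] that obtain n where "n \<in> ?N UNIV B" by auto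
    then obtain x where "n \<ge> 1" "(F ^^ n) x \<in> B" by (elim hitting_timesE)
    then have "F ((F ^^ (n - 1)) x) \<in> B" by (cases n) auto
    then show ?thesis by blast
  qed
  have vne': "(F ^^ k) -` V \<noteq> {}" for k
  proof (induction k)
    case (Suc k)
    have "(F ^^ Suc k) -` V = F -` ((F ^^ k) -` V)"
      by (simp only: funpow_Suc_right vimage_comp)
    then show ?case using vne[OF open_vimage_funpow[OF cont V(1)] Suc] by (simp only: not_False_eq_True)
  qed (use V in simp)
  have Furstenberg: "\<exists>W Z. open W \<and> W \<noteq> {} \<and> open Z \<and> Z \<noteq> {} \<and>
      (\<forall>n\<in>?N W Z. {n..n + k} \<subseteq> ?N U V)" for k
  proof (induction k)
    case 0
    then show ?case using U V by (intro exI[of _ U] exI[of _ V]) auto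
  next
    case (Suc k)
    then obtain W Z where W: "open W" "W \<noteq> {}" and Z: "open Z" "Z \<noteq> {}"
      and WZ: "\<And>n. n \<in> ?N W Z \<Longrightarrow> {n..n + k} \<subseteq> ?N U V" by blast
    \<comment> \<open>Reaching \<open>V'\<close> at time \<open>n\<close> means reaching
      \<open>V\<close> at time \<open>n + Suc k\<close>, the one time to be added to the
      run.\<close>
    define V' where "V' = (F ^^ Suc k) -` V"
    have V': "open V'" "V' \<noteq> {}"
      unfolding V'_def using open_vimage_funpow[OF cont V(1)] vne' by blast+
    from mix[OF W Z U V'] obtain m where m: "m \<in> ?N W U" "m \<in> ?N Z V'" by blast
    \<comment> \<open>A single time \<open>m\<close> carries part of \<open>W\<close> into
      \<open>U\<close> and part of \<open>Z\<close> into \<open>V'\<close>. Shrinking to these parts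
      keeps the induction hypothesis, and \<open>F ^^ m\<close> sends any hit from \<open>W'\<close>
      to \<open>Z'\<close> to a hit from \<open>U\<close> to \<open>V'\<close>.\<close>
    define W' where "W' = W \<inter> (F ^^ m) -` U"
    define Z' where "Z' = Z \<inter> (F ^^ m) -` V'"
    have "open W'" "open Z'"
      unfolding W'_def Z'_def using open_vimage_funpow[OF cont] W Z U V' by blast+
    moreover have "W' \<noteq> {}" "Z' \<noteq> {}"
      unfolding W'_def Z'_def using m by (blast elim: hitting_timesE)+
    moreover have "{n..n + Suc k} \<subseteq> ?N U V" if n: "n \<in> ?N W' Z'" for n
    proof -
      from n obtain x where x: "n \<ge> 1" "x \<in> W'" "(F ^^ n) x \<in> Z'" by (rule hitting_timesE)
      have "(F ^^ m) x \<in> U" using x by (simp add: W'_def)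
      \<comment> \<open>Here the commutation of powers of one map is essential.\<close>
      moreover have "(F ^^ (n + Suc k)) ((F ^^ m) x) = (F ^^ Suc k) ((F ^^ m) ((F ^^ n) x))"
        unfolding funpow_add[symmetric] comp_apply[symmetric, of "F ^^ _" "F ^^ _"]
        by (simp add: ac_simps)
      then have "(F ^^ (n + Suc k)) ((F ^^ m) x) \<in> V"
        using x(3) unfolding Z'_def V'_def by simp
      ultimately have "n + Suc k \<in> ?N U V"
        using x(1) by (intro hitting_timesI) auto
      moreover have "{n..n + k} \<subseteq> ?N U V"
        using x by (intro WZ hitting_timesI[of _ x]) (auto simp: W'_def Z'_def)
      ultimately show ?thesis by (auto simp: atLeastAtMostSuc_conv)
    qed
    ultimately show ?case by blast
  qed
  show ?thesis
    unfolding thickly_syndetic_def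
  proof
    fix k
    from Furstenberg[of k] obtain W Z where "open W" "W \<noteq> {}" "open Z" "Z \<noteq> {}"
      and WZ: "\<forall>n\<in>?N W Z. {n..n + k} \<subseteq> ?N U V" by blast
    then have "syndetic (?N W Z)" by (intro trans)
    then show "syndetic {n. {n..n + k} \<subseteq> ?N U V}"
      by (rule syndetic_mono) (use WZ in blast)
  qed
qed

section \<open>Transfer between the sequence and its limit\<close>

lemma compose_from_add:
  "compose_from f i (m + n) = compose_from f (i + m) n \<circ> compose_from f i m"
  by (induction n) (auto simp: add.assoc)

lemma continuous_compose_from:
  fixes f :: "nat \<Rightarrow> 'a::topological_space \<Rightarrow> 'a"
  assumes "\<And>n. n \<ge> 1 \<Longrightarrow> continuous_on UNIV (f n)"
  shows "continuous_on UNIV (compose_from f 1 n)"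
proof (induction n)
  case (Suc n)
  then show ?case
    unfolding compose_from.simps
    by (rule continuous_on_compose) (rule continuous_on_subset[OF assms], auto)
qed (simp add: id_def)

lemma surj_compose_from:
  assumes "surjective_system f"
  shows "surj (compose_from f 1 n)"
proof (induction n)
  case (Suc n)
  then show ?case
    unfolding compose_from.simps
    by (rule comp_surj) (use assms in \<open>simp add: surjective_system_def\<close>)
qed simp

lemma interior_compose_from_nonempty:
  assumes "feeble_open f" "open U" "U \<noteq> {}"
  shows "interior (compose_from f 1 n ` U) \<noteq> {}"
proof (induction n)
  case 0
  then show ?case using assms by (simp add: interior_open)
next
  case (Suc n)
  \<comment> \<open>The image itself need not be open, so feeble openness is applied to its
    interior.\<close>
  let ?W = "interior (compose_from f 1 n ` U)"
  have "interior (f (1 + n) ` ?W) \<noteq> {}"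
    using assms(1) Suc unfolding feeble_open_def by simp
  moreover have "f (1 + n) ` ?W \<subseteq> compose_from f 1 (Suc n) ` U"
    using interior_subset[of "compose_from f 1 n ` U"] by (fastforce simp: image_comp[symmetric])
  ultimately show ?case using interior_mono by blast
qed

text \<open>A real supremum bounds its family only if the family is bounded above; compactness
  bounds all distances.\<close>

lemma dist_le_sup_dist:
  fixes h1 h2 :: "'a::metric_space \<Rightarrow> 'a"
  assumes "compact (UNIV :: 'a set)"
  shows "dist (h1 x) (h2 x) \<le> sup_dist h1 h2"
proof -
  obtain e where "\<And>x y :: 'a. dist x y \<le> e"
    using compact_imp_bounded[OF assms] unfolding bounded_two_points by blast
  then have "bdd_above (range (\<lambda>x. dist (h1 x) (h2 x)))" by (auto simp: bdd_above_def)
  then show ?thesis unfolding sup_dist_def by (rule cSUP_upper[OF UNIV_I])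
qed

lemma continuous_limit:
  fixes f :: "nat \<Rightarrow> 'a::metric_space \<Rightarrow> 'a"
  assumes "nonautonomous_system f" "converges_uniformly f F"
  shows "continuous_on UNIV F"
proof (rule uniform_limit_theorem)
  have compact: "compact (UNIV :: 'a set)"
    using assms(1) by (simp add: nonautonomous_system_def)
  \<comment> \<open>Continuity is known from index 1 on only, which is enough eventually.\<close>
  show "\<forall>\<^sub>F n in sequentially. continuous_on UNIV (f n)"
    using assms(1) unfolding nonautonomous_system_def eventually_sequentially by blast
  show "uniform_limit UNIV f F sequentially"
  proof (rule uniform_limitI)
    fix e :: real assume "e > 0"
    then have "\<forall>\<^sub>F n in sequentially. sup_dist (f n) F < e"
      using assms(2) unfolding converges_uniformly_def by (rule order_tendstoD(2)[rotated])
    then show "\<forall>\<^sub>F n in sequentially. \<forall>x\<in>UNIV. dist (f n x) (F x) < e"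
      by eventually_elim (use dist_le_sup_dist[OF compact] le_less_trans in blast)
  qed
qed simp

text \<open>Here \<open>s\<close> counts the maps already applied, so the tail starts at index
  \<open>1 + s\<close>, as in \<open>compose_from_add\<close> for \<open>i = 1\<close>.\<close>

lemma converges_collectivelyE:
  fixes f :: "nat \<Rightarrow> 'a::metric_space \<Rightarrow> 'a"
  assumes "nonautonomous_system f" "converges_collectively f F" "e > 0"
  obtains r where "\<And>s k x. s \<ge> r \<Longrightarrow> k \<ge> 1 \<Longrightarrow> dist (compose_from f (1 + s) k x) ((F ^^ k) x) < e"
proof -
  have compact: "compact (UNIV :: 'a set)"
    using assms(1) by (simp add: nonautonomous_system_def)
  from assms(2,3) obtain r where "\<forall>s\<ge>r. \<forall>k\<ge>1. sup_dist (compose_from f s k) (F ^^ k) < e"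
    unfolding converges_collectively_def by blast
  then have "dist (compose_from f (1 + s) k x) ((F ^^ k) x) < e" if "s \<ge> r" "k \<ge> 1" for s k x
    using that by (intro le_less_trans[OF dist_le_sup_dist[OF compact]]) auto
  then show thesis by (rule that)
qed

text \<open>Halving the radius of a ball inside \<open>V\<close> leaves room for an error below
  \<open>e\<close>: orbits of the sequence and of its limit can then replace each other.\<close>

lemma open_half_ballE:
  fixes V :: "'a::metric_space set"
  assumes "open V" "V \<noteq> {}"
  obtains v e where "e > 0" "v \<in> V" "\<And>x y. x \<in> ball v e \<Longrightarrow> dist x y < e \<Longrightarrow> y \<in> V"
proof -
  from assms obtain v d where vd: "v \<in> V" "d > 0" "ball v d \<subseteq> V"
    by (meson ex_in_conv openE)
  have "y \<in> V" if "x \<in> ball v (d / 2)" "dist x y < d / 2" for x y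
  proof -
    have "dist v y < d" using that dist_triangle[of v y x] by simp
    then show ?thesis using vd by auto
  qed
  then show thesis using vd by (intro that[of "d / 2" v]) auto
qed

text \<open>Take for \<open>W\<close> the preimage of \<open>U\<close> under the first
  \<open>s\<close> maps, nonempty by surjectivity. A point hitting \<open>Z\<close> at time
  \<open>s + k\<close> is in \<open>U\<close> at time \<open>s\<close>, and its last
  \<open>k\<close> steps stay close to \<open>F ^^ k\<close>. Since \<open>r\<close> and
  \<open>Z\<close> depend on \<open>V\<close> alone, two targets can later share one
  \<open>s\<close>.\<close>

lemma hitting_times_limit_from_sequence:
  fixes f :: "nat \<Rightarrow> 'a::metric_space \<Rightarrow> 'a"
  assumes "nonautonomous_system f" "converges_collectively f F" "surjective_system f"
    and V: "open V" "V \<noteq> {}"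
  obtains r Z where "open Z" "Z \<noteq> {}"
    "\<And>s U. s \<ge> r \<Longrightarrow> open U \<Longrightarrow> U \<noteq> {} \<Longrightarrow> \<exists>W. open W \<and> W \<noteq> {} \<and>
      (\<forall>k\<ge>1. s + k \<in> hitting_times (compose_from f 1) W Z \<longrightarrow> k \<in> hitting_times (\<lambda>n. F ^^ n) U V)"
proof -
  obtain v e where ve: "e > 0" "v \<in> V" "\<And>x y. x \<in> ball v e \<Longrightarrow> dist x y < e \<Longrightarrow> y \<in> V"
    using open_half_ballE[OF V] by metis
  obtain r where
    r: "\<And>s k x. s \<ge> r \<Longrightarrow> k \<ge> 1 \<Longrightarrow> dist (compose_from f (1 + s) k x) ((F ^^ k) x) < e"
    using converges_collectivelyE[OF assms(1,2) ve(1)] by metis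
  have "\<exists>W. open W \<and> W \<noteq> {} \<and> (\<forall>k\<ge>1. s + k \<in> hitting_times (compose_from f 1) W (ball v e)
      \<longrightarrow> k \<in> hitting_times (\<lambda>n. F ^^ n) U V)"
    if s: "s \<ge> r" and U: "open U" "U \<noteq> {}" for s U
  proof (intro exI[of _ "compose_from f 1 s -` U"] conjI allI impI)
    show "open (compose_from f 1 s -` U)"
      using assms(1) unfolding nonautonomous_system_def
      by (intro open_vimage U continuous_compose_from) blast
    show "compose_from f 1 s -` U \<noteq> {}"
      using surj_compose_from[OF assms(3), of s] U(2) by (metis surj_vimage_empty)
  next
    fix k :: nat assume k: "k \<ge> 1"
      and "s + k \<in> hitting_times (compose_from f 1) (compose_from f 1 s -` U) (ball v e)"
    then obtain x where x: "compose_from f 1 s x \<in> U"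
      "compose_from f (1 + s) k (compose_from f 1 s x) \<in> ball v e"
      by (auto elim!: hitting_timesE simp: compose_from_add)
    show "k \<in> hitting_times (\<lambda>n. F ^^ n) U V"
      using ve(3)[OF x(2) r[OF s k]] by (rule hitting_timesI[where h = "\<lambda>n. F ^^ n", OF k x(1)])
  qed
  then show thesis using ve(1) by (intro that[of "ball v e" r]) auto
qed

text \<open>Feeble openness gives the image of \<open>U\<close> under the first \<open>r\<close>
  maps a nonempty interior, which serves as \<open>W\<close>. Each of its points is reached from
  \<open>U\<close> at time \<open>r\<close>, after which the sequence follows the powers of
  \<open>F\<close> closely.\<close>

lemma hitting_times_sequence_from_limit:
  fixes f :: "nat \<Rightarrow> 'a::metric_space \<Rightarrow> 'a"
  assumes "nonautonomous_system f" "converges_collectively f F" "feeble_open f"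
    and U: "open U" "U \<noteq> {}" and V: "open V" "V \<noteq> {}"
  obtains r W Z where "open W" "W \<noteq> {}" "open Z" "Z \<noteq> {}"
    "\<And>k. k \<in> hitting_times (\<lambda>n. F ^^ n) W Z \<Longrightarrow> r + k \<in> hitting_times (compose_from f 1) U V"
proof -
  obtain v e where ve: "e > 0" "v \<in> V" "\<And>x y. x \<in> ball v e \<Longrightarrow> dist x y < e \<Longrightarrow> y \<in> V"
    using open_half_ballE[OF V] by metis
  obtain r where
    r: "\<And>s k x. s \<ge> r \<Longrightarrow> k \<ge> 1 \<Longrightarrow> dist (compose_from f (1 + s) k x) ((F ^^ k) x) < e"
    using converges_collectivelyE[OF assms(1,2) ve(1)] by metis
  let ?W = "interior (compose_from f 1 r ` U)"
  have "r + k \<in> hitting_times (compose_from f 1) U V"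
    if "k \<in> hitting_times (\<lambda>n. F ^^ n) ?W (ball v e)" for k
  proof -
    from that obtain y where y: "k \<ge> 1" "y \<in> ?W" "(F ^^ k) y \<in> ball v e"
      by (rule hitting_timesE)
    then obtain x where x: "x \<in> U" "y = compose_from f 1 r x"
      using interior_subset by blast
    have "compose_from f (1 + r) k y \<in> V"
      using r[of r k y] y by (intro ve(3)[OF y(3)]) (auto simp: dist_commute)
    then show ?thesis
      using x y(1) by (intro hitting_timesI[of _ x]) (auto simp: compose_from_add)
  qed
  then show thesis
    using ve(1) interior_compose_from_nonempty[OF assms(3) U, of r]
    by (intro that[of ?W "ball v e" r]) auto
qed

section \<open>Weak mixing at arbitrarily late times\<close>

text \<open>At any one time \<open>v\<close> has a single image, so \<open>{v}\<close> cannot hit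
  both \<open>{v}\<close> and its complement; weak mixing thus forces the complement to be
  empty.\<close>

lemma weakly_mixing_isolated_point:
  fixes f :: "nat \<Rightarrow> 'a::t1_space \<Rightarrow> 'a" and v :: 'a
  assumes "weakly_mixing f" "open {v}"
  shows "UNIV = {v}"
proof (rule ccontr)
  assume "UNIV \<noteq> {v}"
  then have "- {v} \<noteq> {}" by blast
  moreover have "open (- {v})" by (intro open_Compl closed_singleton)
  ultimately have "hitting_times (compose_from f 1) {v} {v} \<inter>
      hitting_times (compose_from f 1) {v} (- {v}) \<noteq> {}"
    using assms unfolding weakly_mixing_iff by blast
  then show False by (auto elim!: hitting_timesE)
qed

text \<open>Removing all but one point from a finite open set removes a closed set, which would
  leave an open singleton.\<close>

lemma infinite_open_if_no_isolated_points:
  fixes V :: "'a::t1_space set"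
  assumes "\<And>v::'a. \<not> open {v}" "open V" "V \<noteq> {}"
  shows "infinite V"
proof
  assume fin: "finite V"
  from assms(3) obtain v where v: "v \<in> V" by blast
  have "open (V - (V - {v}))"
    using assms(2) fin by (intro open_Diff finite_imp_closed) auto
  moreover have "V - (V - {v}) = {v}" using v by blast
  ultimately show False using assms(1) by simp
qed

text \<open>
  Without isolated points, \<open>U1\<close> and \<open>V1\<close> can be shrunk so that the first \<open>r\<close> times hit nothing.
\<close>
lemma weakly_mixing_late:
  fixes f :: "nat \<Rightarrow> 'a::metric_space \<Rightarrow> 'a"
  assumes "nonautonomous_system f" "weakly_mixing f"
    and U1: "open U1" "U1 \<noteq> {}" and U2: "open U2" "U2 \<noteq> {}"
    and V1: "open V1" "V1 \<noteq> {}" and V2: "open V2" "V2 \<noteq> {}"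
  shows "\<exists>n>r. n \<in> hitting_times (compose_from f 1) U1 V1 \<inter> hitting_times (compose_from f 1) U2 V2"
proof (cases "\<exists>v::'a. open {v}")
  case True
  then obtain v :: 'a where v: "UNIV = {v}"
    using weakly_mixing_isolated_point[OF assms(2)] by blast
  then have all: "x = v" for x :: 'a by blast
  have "v \<in> U1" "v \<in> U2" "v \<in> V1" "v \<in> V2"
    using U1 U2 V1 V2 all by (metis ex_in_conv)+
  \<comment> \<open>In a one-point space every positive time is a hit.\<close>
  then have "Suc r \<in> hitting_times (compose_from f 1) U1 V1 \<inter> hitting_times (compose_from f 1) U2 V2"
    using all[of "compose_from f 1 (Suc r) v"] by (intro IntI hitting_timesI[of _ v]) auto
  then show ?thesis by blast
next
  case False
  from U1 obtain x where x: "x \<in> U1" by blast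
  \<comment> \<open>The initial orbit of \<open>x\<close> is finite, so the infinite set
    \<open>V1\<close> has a point \<open>y\<close> off it, even with a closed ball around
    \<open>y\<close> disjoint from it.\<close>
  define P where "P = (\<lambda>n. compose_from f 1 n x) ` {..r}"
  have "finite P" by (simp add: P_def)
  moreover have "infinite V1"
    using False by (intro infinite_open_if_no_isolated_points V1) blast
  ultimately obtain y where y: "y \<in> V1" "y \<in> - P"
    by (metis ComplI finite_subset subsetI)
  have "open (- P)" using \<open>finite P\<close> by (simp add: finite_imp_closed open_Compl)
  then obtain d where d: "d > 0" "cball y d \<subseteq> - P"
    using y(2) by (meson open_contains_cball)
  \<comment> \<open>Points of \<open>U\<close> avoid the closed ball up to time \<open>r\<close>;
    the ball is closed to make \<open>U\<close> open, and its open version yields the target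
    \<open>V\<close>.\<close>
  define U where "U = U1 \<inter> (\<Inter>n\<le>r. compose_from f 1 n -` (- cball y d))"
  define V where "V = V1 \<inter> ball y d"
  have "open U" unfolding U_def
    using assms(1) unfolding nonautonomous_system_def
    by (intro open_Int U1 open_INT finite_atMost ballI open_vimage continuous_compose_from)
      (auto simp: open_Compl)
  moreover have "x \<in> U" using x d(2) by (auto simp: U_def P_def)
  moreover have "open V" "y \<in> V" using V1 y d by (auto simp: V_def)
  ultimately obtain n where n: "n \<in> hitting_times (compose_from f 1) U V"
    "n \<in> hitting_times (compose_from f 1) U2 V2"
    using assms(2) U2 V2 unfolding weakly_mixing_iff by (metis IntE ex_in_conv)
  have "\<not> n \<le> r"
  proof
    assume "n \<le> r"
    from n(1) obtain z where "z \<in> U" "compose_from f 1 n z \<in> V" by (rule hitting_timesE)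
    with \<open>n \<le> r\<close> have "compose_from f 1 n z \<in> - cball y d" "compose_from f 1 n z \<in> ball y d"
      unfolding U_def V_def by blast+
    then show False by simp
  qed
  moreover have "n \<in> hitting_times (compose_from f 1) U1 V1"
    using n(1) hitting_times_mono[of U U1 V V1] by (auto simp: U_def V_def)
  ultimately show ?thesis using n(2) by (intro exI[of _ n]) auto
qed

lemma thickly_syndetic_hitting_times:
  fixes f :: "nat \<Rightarrow> 'a::metric_space \<Rightarrow> 'a"
  assumes sys: "nonautonomous_system f" and "feeble_open f" and surj: "surjective_system f"
    and "converges_uniformly f F" and coll: "converges_collectively f F"
    and trans: "syndetically_transitive f" and mix: "weakly_mixing f"
    and "open U" "U \<noteq> {}" "open V" "V \<noteq> {}"
  shows "thickly_syndetic (hitting_times (compose_from f 1) U V)"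
proof -
  let ?H = "hitting_times (compose_from f 1)" and ?N = "hitting_times (\<lambda>n. F ^^ n)"
  have transF: "syndetic (?N U V)"
    if U: "open U" "U \<noteq> {}" and V: "open V" "V \<noteq> {}" for U V
  proof -
    obtain r Z where Z: "open Z" "Z \<noteq> {}"
      and r: "\<And>s U. s \<ge> r \<Longrightarrow> open U \<Longrightarrow> U \<noteq> {} \<Longrightarrow> \<exists>W. open W \<and> W \<noteq> {} \<and>
        (\<forall>k\<ge>1. s + k \<in> ?H W Z \<longrightarrow> k \<in> ?N U V)"
      using hitting_times_limit_from_sequence[OF sys coll surj V] by metis
    from r[OF order_refl U] obtain W where W: "open W" "W \<noteq> {}"
      and WZ: "\<And>k. k \<ge> 1 \<Longrightarrow> r + k \<in> ?H W Z \<Longrightarrow> k \<in> ?N U V" by blast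
    have "syndetic (?H W Z)"
      using trans W Z unfolding syndetically_transitive_iff by blast
    then obtain M where M: "\<And>i. i \<ge> 1 \<Longrightarrow> \<exists>n\<in>?H W Z. i \<le> n \<and> n \<le> i + M"
      by (rule syndeticE) blast
    show ?thesis
    proof (rule syndeticI[where M = M])
      fix i :: nat assume i: "i \<ge> 1"
      \<comment> \<open>Searching from \<open>r + i\<close> makes \<open>n - r\<close> at least
        \<open>i\<close>, hence positive, and keeps the gap \<open>M\<close>.\<close>
      with M[of "r + i"] obtain n where n: "n \<in> ?H W Z" "r + i \<le> n" "n \<le> r + i + M" by auto
      then have "n - r \<in> ?N U V" using i by (intro WZ) auto
      then show "\<exists>k\<in>?N U V. i \<le> k \<and> k \<le> i + M"
        using n by (intro bexI[of _ "n - r"]) auto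
    qed
  qed
  have mixF: "?N U1 V1 \<inter> ?N U2 V2 \<noteq> {}"
    if U: "open U1" "U1 \<noteq> {}" "open U2" "U2 \<noteq> {}" and V: "open V1" "V1 \<noteq> {}" "open V2" "V2 \<noteq> {}"
    for U1 U2 V1 V2
  proof -
    obtain r1 Z1 where Z1: "open Z1" "Z1 \<noteq> {}"
      and r1: "\<And>s U. s \<ge> r1 \<Longrightarrow> open U \<Longrightarrow> U \<noteq> {} \<Longrightarrow> \<exists>W. open W \<and> W \<noteq> {} \<and>
        (\<forall>k\<ge>1. s + k \<in> ?H W Z1 \<longrightarrow> k \<in> ?N U V1)"
      using hitting_times_limit_from_sequence[OF sys coll surj V(1,2)] by metis
    obtain r2 Z2 where Z2: "open Z2" "Z2 \<noteq> {}"
      and r2: "\<And>s U. s \<ge> r2 \<Longrightarrow> open U \<Longrightarrow> U \<noteq> {} \<Longrightarrow> \<exists>W. open W \<and> W \<noteq> {} \<and>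
        (\<forall>k\<ge>1. s + k \<in> ?H W Z2 \<longrightarrow> k \<in> ?N U V2)"
      using hitting_times_limit_from_sequence[OF sys coll surj V(3,4)] by metis
    \<comment> \<open>A common delay lets one time of the sequence give the same time
      \<open>n - s\<close> for both pairs.\<close>
    define s where "s = max r1 r2"
    from r1[of s, OF _ U(1,2)] obtain W1 where W1: "open W1" "W1 \<noteq> {}"
      and WZ1: "\<And>k. k \<ge> 1 \<Longrightarrow> s + k \<in> ?H W1 Z1 \<Longrightarrow> k \<in> ?N U1 V1" unfolding s_def by auto
    from r2[of s, OF _ U(3,4)] obtain W2 where W2: "open W2" "W2 \<noteq> {}"
      and WZ2: "\<And>k. k \<ge> 1 \<Longrightarrow> s + k \<in> ?H W2 Z2 \<Longrightarrow> k \<in> ?N U2 V2" unfolding s_def by auto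
    \<comment> \<open>Plain weak mixing might return a time up to \<open>s\<close>; a later one is
      required for \<open>n - s\<close> to be positive.\<close>
    obtain n where n: "n > s" "n \<in> ?H W1 Z1 \<inter> ?H W2 Z2"
      using weakly_mixing_late[OF sys mix W1 W2 Z1 Z2] by blast
    then have "n - s \<in> ?N U1 V1 \<inter> ?N U2 V2" by (intro IntI WZ1 WZ2) auto
    then show ?thesis by blast
  qed
  obtain r W Z where W: "open W" "W \<noteq> {}" and Z: "open Z" "Z \<noteq> {}"
    and r: "\<And>k. k \<in> ?N W Z \<Longrightarrow> r + k \<in> ?H U V"
    using hitting_times_sequence_from_limit[OF sys coll assms(2) assms(8-11)] by metis
  have "continuous_on UNIV F" using continuous_limit assms(1,4) by blast
  from thickly_syndetic_hitting_times_funpow[OF this transF mixF W Z]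
  have "thickly_syndetic (?N W Z)" .
  then show ?thesis by (rule thickly_syndetic_translate) (rule r)
qed

section \<open>Products\<close>

lemma compose_from_product_system:
  "compose_from (product_system f g) i n = map_prod (compose_from f i n) (compose_from g i n)"
  by (induction n) (auto simp: product_system_def map_prod.id map_prod_compose)

text \<open>One inclusion suffices because thick syndeticity passes to supersets.\<close>

lemma hitting_times_product_system:
  "hitting_times (compose_from f i) A B \<inter> hitting_times (compose_from g i) C D \<subseteq>
     hitting_times (compose_from (product_system f g) i) (A \<times> C) (B \<times> D)"
proof
  fix n assume "n \<in> hitting_times (compose_from f i) A B \<inter> hitting_times (compose_from g i) C D"
  then obtain x y where "n \<ge> 1" "x \<in> A" "compose_from f i n x \<in> B" "y \<in> C" "compose_from g i n y \<in> D"
    by (auto elim!: hitting_timesE)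
  then show "n \<in> hitting_times (compose_from (product_system f g) i) (A \<times> C) (B \<times> D)"
    by (intro hitting_timesI[of _ "(x, y)"]) (auto simp: compose_from_product_system)
qed

lemma open_contains_Times:
  assumes "open U" "U \<noteq> {}"
  obtains A B where "open A" "A \<noteq> {}" "open B" "B \<noteq> {}" "A \<times> B \<subseteq> U"
proof -
  from assms obtain p where "p \<in> U" by blast
  then show thesis using open_prod_elim[OF assms(1)] that by (metis SigmaE empty_iff)
qed

theorem theorem14:
  fixes f :: "nat \<Rightarrow> 'a::metric_space \<Rightarrow> 'a" and F :: "'a \<Rightarrow> 'a"
    and g :: "nat \<Rightarrow> 'b::metric_space \<Rightarrow> 'b" and G :: "'b \<Rightarrow> 'b"
  assumes "nonautonomous_system f" and "nonautonomous_system g"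
    and "feeble_open f" and "surjective_system f"
    and "feeble_open g" and "surjective_system g"
    and "converges_uniformly f F" and "converges_uniformly g G"
    and "converges_collectively f F" and "converges_collectively g G"
    and "syndetically_transitive f" and "weakly_mixing f"
    and "syndetically_transitive g" and "weakly_mixing g"
  shows "syndetically_transitive (product_system f g) \<and> weakly_mixing (product_system f g)"
proof -
  let ?H = "hitting_times (compose_from (product_system f g) 1)"
  have thick: "thickly_syndetic (?H U V)"
    if U: "open U" "U \<noteq> {}" and V: "open V" "V \<noteq> {}" for U V
  proof -
    obtain A B where AB: "open A" "A \<noteq> {}" "open B" "B \<noteq> {}" "A \<times> B \<subseteq> U"
      using open_contains_Times[OF U] .
    obtain C D where CD: "open C" "C \<noteq> {}" "open D" "D \<noteq> {}" "C \<times> D \<subseteq> V"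
      using open_contains_Times[OF V] .
    have "thickly_syndetic (hitting_times (compose_from f 1) A C)"
      using assms AB CD by (intro thickly_syndetic_hitting_times)
    moreover have "thickly_syndetic (hitting_times (compose_from g 1) B D)"
      using assms AB CD by (intro thickly_syndetic_hitting_times)
    ultimately have "thickly_syndetic
        (hitting_times (compose_from f 1) A C \<inter> hitting_times (compose_from g 1) B D)"
      by (rule thickly_syndetic_Int)
    then show ?thesis
      by (rule thickly_syndetic_mono)
        (use hitting_times_product_system hitting_times_mono[OF AB(5) CD(5)] in blast)
  qed
  have "syndetically_transitive (product_system f g)"
    unfolding syndetically_transitive_iff
    by (intro allI impI thickly_syndetic_imp_syndetic thick; elim conjE; assumption)
  \<comment> \<open>The two hitting sets are thickly syndetic, so their intersection is too and in
    particular contains a common time.\<close>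
  moreover have "weakly_mixing (product_system f g)"
    unfolding weakly_mixing_iff
    by (intro allI impI thickly_syndetic_nonempty thickly_syndetic_Int thick; elim conjE; assumption)
  ultimately show ?thesis ..
qed

end
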